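(* Let $d\geq 2$ be a fixed integer, and let $(X_{N(t)})_{t}$ be a well-separated sequence in which, for each $t\in\mathbb{N}$, $X_{N(t)}\subset\mathbb{S}^{d}$ is a spherical $t$-design consisting of $N=N(t)$ points, where $N(t)\asymp t^{d}$. Then, as $t\to\infty$ (equivalently $N=N(t)\to\infty$), the logarithmic energy satisfies $$E_{\log}^{(d)}(X_{N})=N^{2}\int_{\mathbb{S}^{d}}\int_{\mathbb{S}^{d}}\log\frac{1}{|\mathbf{x}-\mathbf{y}|}\,d\sigma_{d}(\mathbf{x})\,d\sigma_{d}(\mathbf{y})-\frac{1}{d}N\log N+\mathcal{O}(N).$$
   Context: $\mathbb{S}^{d}=\{\mathbf{x}\in\mathbb{R}^{d+1}:|\mathbf{x}|=1\}$ is the unit sphere, $|\cdot|$ is the Euclidean norm on $\mathbb{R}^{d+1}$, and $\sigma_{d}$ is the Lebesgue surface measure on $\mathbb{S}^{d}$ normalized by $\sigma_{d}(\mathbb{S}^{d})=1$. A spherical $t$-design is a finite set $X_N\subset\mathbb{S}^{d}$ of cardinality $N$ such that $\frac1N\sum_{\mathbf{x}\in X_N}p(\mathbf{x})=\int_{\mathbb{S}^{d}}p(\mathbf{x})\,d\sigma_{d}(\mathbf{x})$ for every spherical polynomial $p$ (restriction to $\mathbb{S}^d$ of a polynomial in $d+1$ real variables) of total degree at most $t$. A sequence of $N$-point sets $X_{N}=\{\mathbf{x}_{1},\ldots,\mathbf{x}_{N}\}\subset\mathbb{S}^d$ is called well-separated if there is a constant $c_{1}>0$ (the same for all sets in the sequence)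 such that $\min_{i\neq j}|\mathbf{x}_{i}-\mathbf{x}_{j}|>c_{1}N^{-1/d}$ for every set in the sequence. The logarithmic energy of an $N$-point set $X_N=\{\mathbf{x}_1,\ldots,\mathbf{x}_N\}$ of distinct points is $E_{\log}^{(d)}(X_{N})=\sum_{i,j=1,\ i\neq j}^{N}\log\frac{1}{|\mathbf{x}_{i}-\mathbf{x}_{j}|}$ (sum over ordered pairs). The notation $a_{t}\asymp b_{t}$ means that there exist constants $C_{1},C_{2}>0$ independent of $t$ with $C_{1}a_{t}\leq b_{t}\leq C_{2}a_{t}$ for all $t$. The constant implied by $\mathcal{O}(N)$ is independent of $t$ (and $N$). *)

theory Defs
  imports "HOL-Analysis.Analysis" "HOL-Library.Landau_Symbols"
begin

text \<open>
  The ambient space is \<open>real ^ 'n\<close> with \<open>CARD('n) = d + 1\<close>, and the unit sphere is \<open>sphere 0 1\<close>.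
  The normalized surface measure of a Borel set \<open>A\<close> of the sphere is the volume of the cone
  \<open>{r x | 0 < r \<le> 1, x \<in> A}\<close> divided by the volume of the unit ball, i.e. the image of the uniform
  distribution on the ball under radial projection. The origin, which is not projected to the
  sphere, is a null set.
\<close>

definition sphere_measure :: "(real ^ 'n) measure" where
  "sphere_measure =
     restrict_space (distr (uniform_measure lborel (cball 0 1)) borel (\<lambda>x. x /\<^sub>R norm x)) (sphere 0 1)"

text \<open>
  Functions induced by polynomials of total degree at most \<open>t\<close> in the coordinates; \<open>\<alpha>\<close> is the
  exponent vector of a monomial. The set of exponent vectors is finite.
\<close>

definition polynomials_upto :: "nat \<Rightarrow> (real ^ 'n \<Rightarrow> real) set" where
  "polynomials_upto t =
     {p. \<exists>c :: ('n \<Rightarrow> nat) \<Rightarrow> real.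
           p = (\<lambda>x. \<Sum>\<alpha> | sum \<alpha> UNIV \<le> t. c \<alpha> * (\<Prod>i\<in>UNIV. (x $ i) ^ \<alpha> i))}"

definition spherical_design :: "nat \<Rightarrow> (real ^ 'n) set \<Rightarrow> bool" where
  "spherical_design t X \<longleftrightarrow>
     finite X \<and> X \<subseteq> sphere 0 1 \<and>
     (\<forall>p\<in>polynomials_upto t. (1 / real (card X)) * (\<Sum>x\<in>X. p x) = (LINT x|sphere_measure. p x))"

text \<open>Sequences are indexed by \<open>t \<ge> 1\<close>; the value at \<open>0\<close> is irrelevant.\<close>

definition well_separated :: "nat \<Rightarrow> (nat \<Rightarrow> (real ^ 'n) set) \<Rightarrow> bool" where
  "well_separated d X \<longleftrightarrow>
     (\<exists>c\<^sub>1>0. \<forall>t\<ge>1. \<forall>x\<in>X t. \<forall>y\<in>X t. x \<noteq> y \<longrightarrow>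
        norm (x - y) > c\<^sub>1 * real (card (X t)) powr (- 1 / real d))"

definition same_order :: "(nat \<Rightarrow> real) \<Rightarrow> (nat \<Rightarrow> real) \<Rightarrow> bool" where
  "same_order a b \<longleftrightarrow> (\<exists>C\<^sub>1>0. \<exists>C\<^sub>2>0. \<forall>t\<ge>1. C\<^sub>1 * a t \<le> b t \<and> b t \<le> C\<^sub>2 * a t)"

definition log_energy :: "(real ^ 'n) set \<Rightarrow> real" where
  "log_energy X = (\<Sum>x\<in>X. \<Sum>y\<in>X - {x}. ln (1 / norm (x - y)))"

text \<open>
  The integrand is \<open>0\<close> on the diagonal, because \<open>1 / 0 = 0\<close> and \<open>ln 0 = 0\<close>; the diagonal is a null
  set, so this has no effect.
\<close>

definition sphere_log_integral :: "'n::finite itself \<Rightarrow> real" where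
  "sphere_log_integral _ =
     (LINT y|(sphere_measure :: (real ^ 'n) measure). LINT x|sphere_measure. ln (1 / norm (x - y)))"

lemma finite_exponents: "finite {\<alpha> :: 'n::finite \<Rightarrow> nat. sum \<alpha> UNIV \<le> t}"
proof (rule finite_subset)
  show "{\<alpha> :: 'n \<Rightarrow> nat. sum \<alpha> UNIV \<le> t} \<subseteq> (UNIV :: 'n set) \<rightarrow>\<^sub>E {..t}"
  proof (clarsimp simp: PiE_iff)
    fix \<alpha> :: "'n \<Rightarrow> nat" and i assume "sum \<alpha> UNIV \<le> t"
    moreover have "\<alpha> i \<le> sum \<alpha> UNIV" by (rule member_le_sum) auto
    ultimately show "\<alpha> i \<le> t" by linarith
  qed
  show "finite ((UNIV :: 'n set) \<rightarrow>\<^sub>E {..t})"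
    by (rule finite_PiE) auto
qed

lemma space_sphere_measure: "space (sphere_measure :: (real ^ 'n) measure) = sphere 0 1"
  by (simp add: sphere_measure_def space_restrict_space)

lemma radial_measurable: "(\<lambda>x :: real ^ 'n. x /\<^sub>R norm x) \<in> borel_measurable borel"
  by measurable

lemma emeasure_sphere_measure:
  fixes A :: "(real ^ 'n) set"
  assumes "A \<in> sets borel" "A \<subseteq> sphere 0 1"
  shows "emeasure sphere_measure A =
    emeasure lborel {r *\<^sub>R x |r x. 0 < r \<and> r \<le> 1 \<and> x \<in> A} / emeasure lborel (cball 0 1 :: (real ^ 'n) set)"
proof -
  let ?f = "\<lambda>x :: real ^ 'n. x /\<^sub>R norm x"
  have f: "?f \<in> measurable (uniform_measure lborel (cball 0 1)) borel"
    using radial_measurable by (simp add: measurable_def)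
  have m: "?f -` A \<in> sets borel"
    using measurable_sets[OF radial_measurable assms(1)] by simp
  have cone: "cball 0 1 \<inter> ?f -` A = {r *\<^sub>R x |r x. 0 < r \<and> r \<le> 1 \<and> x \<in> A}"
  proof (intro equalityI subsetI)
    fix z assume z: "z \<in> cball 0 1 \<inter> ?f -` A"
    then have "z \<noteq> 0" using assms(2) by auto
    then have "z = norm z *\<^sub>R ?f z" "0 < norm z" by auto
    with z show "z \<in> {r *\<^sub>R x |r x. 0 < r \<and> r \<le> 1 \<and> x \<in> A}"
      by (smt (verit, best) IntE mem_Collect_eq mem_cball_0 vimageE)
  next
    fix z assume "z \<in> {r *\<^sub>R x |r x. 0 < r \<and> r \<le> 1 \<and> x \<in> A}"
    then obtain r x where z: "z = r *\<^sub>R x" "0 < r" "r \<le> 1" "x \<in> A" by blast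
    moreover have "norm x = 1" using z(4) assms(2) by auto
    ultimately show "z \<in> cball 0 1 \<inter> ?f -` A" by simp
  qed
  have "emeasure sphere_measure A = emeasure (distr (uniform_measure lborel (cball 0 1)) borel ?f) A"
    unfolding sphere_measure_def by (rule emeasure_restrict_space) (use assms in auto)
  also have "\<dots> = emeasure (uniform_measure lborel (cball 0 1)) (?f -` A)"
    using emeasure_distr[OF f assms(1)] by simp
  also have "\<dots> = emeasure lborel (cball 0 1 \<inter> ?f -` A) / emeasure lborel (cball 0 1 :: (real ^ 'n) set)"
    by (rule emeasure_uniform_measure) (use m in auto)
  finally show ?thesis unfolding cone .
qed

end

theory Submission
  imports Defs "HOL-Computational_Algebra.Polynomial"
begin

text \<open>
  On the sphere \<open>ln (1 / \<bar>x - y\<bar>) = - ln (2 w) / 2\<close> with \<open>w = 1 - x \<bullet> y\<close>. Let \<open>Q\<close> be the \<open>d\<close>-th power of the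
  normalized Fejer kernel in \<open>w\<close>, with \<open>Q(0) = 1\<close> and of degree at most \<open>t\<close>. The polynomial \<open>P\<close> with
  \<open>P' = - (1 - Q) / (2 w)\<close> and \<open>P(2) = - ln 4 / 2\<close> lies below the kernel, and the difference decays like
  \<open>(t \<bar>x - y\<bar>)\<close> to the power \<open>- 2 d\<close>, while \<open>P(0) = ln t + O(1)\<close>. The design property makes the double
  sum of \<open>P\<close> over the points equal to \<open>N\<^sup>2\<close> times its double integral. The remainder contributes \<open>O(N)\<close>
  both to the energy, by separation, and to \<open>N\<^sup>2\<close> times the integral, as caps of radius \<open>r\<close> have
  measure \<open>O(r\<^sup>d)\<close>. Removing the diagonal costs \<open>N P(0) = N ln N / d + O(N)\<close>.
\<close>

subsection \<open>One-sided polynomial approximation of the logarithm\<close>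

text \<open>With w = 1 - cos \<theta> this is (1 - cos (n \<theta>)) / w, that is, n times the
  classical Fejer kernel. The recurrence is the three-term recurrence of cos (n \<theta>) divided by
  w, so that polynomiality and the degree are immediate.\<close>

fun fejer :: "nat \<Rightarrow> real poly" where
  "fejer 0 = 0"
| "fejer (Suc 0) = 1"
| "fejer (Suc (Suc n)) = [:2, -2:] * fejer (Suc n) - fejer n + [:2:]"

lemma fejer_cos: "poly (fejer n) (1 - cos \<theta>) * (1 - cos \<theta>) = 1 - cos (real n * \<theta>)"
proof (induction n rule: fejer.induct)
  case (3 n)
  have "cos (real (Suc (Suc n)) * \<theta>) + cos (real n * \<theta>) = 2 * cos \<theta> * cos (real (Suc n) * \<theta>)"
    using cos_add[of "real (Suc n) * \<theta>" \<theta>] cos_diff[of "real (Suc n) * \<theta>" \<theta>]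
    by (simp add: algebra_simps)
  with 3 show ?case by (simp add: algebra_simps) algebra
qed auto

text \<open>At w = 0 the cosine identity only says 0 = 0, so the value comes from the
  recurrence.\<close>

lemma poly_fejer_0: "poly (fejer n) 0 = (real n)\<^sup>2"
  by (induction n rule: fejer.induct) (auto simp: power2_eq_square algebra_simps)

lemma degree_fejer: "degree (fejer n) \<le> n - 1"
proof (induction n rule: fejer.induct)
  case (3 n)
  have "degree ([:2, -2:] * fejer (Suc n)) \<le> Suc n"
    using degree_mult_le[of "[:2, -2:]" "fejer (Suc n)"] 3 by simp
  with 3 show ?case by (auto intro!: degree_add_le degree_diff_le)
qed auto

lemma abs_sin_mult_le: "\<bar>sin (real n * x)\<bar> \<le> real n * \<bar>sin x\<bar>"
proof (induction n)
  case (Suc n)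
  have "\<bar>sin (real (Suc n) * x)\<bar> = \<bar>sin (real n * x) * cos x + cos (real n * x) * sin x\<bar>"
    by (simp add: algebra_simps sin_add)
  also have "\<dots> \<le> \<bar>sin (real n * x)\<bar> * \<bar>cos x\<bar> + \<bar>cos (real n * x)\<bar> * \<bar>sin x\<bar>"
    by (metis abs_mult abs_triangle_ineq)
  also have "\<dots> \<le> \<bar>sin (real n * x)\<bar> * 1 + 1 * \<bar>sin x\<bar>"
    by (intro add_mono mult_mono) auto
  finally show ?case using Suc by (simp add: algebra_simps)
qed auto

lemma one_minus_cos_mult_le: "1 - cos (real n * \<theta>) \<le> (real n)\<^sup>2 * (1 - cos \<theta>)"
proof -
  have h: "1 - cos y = 2 * (sin (y / 2))\<^sup>2" for y :: real
    using cos_double_sin[of "y / 2"] by simp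
  have "(sin (real n * (\<theta> / 2)))\<^sup>2 \<le> (real n * \<bar>sin (\<theta> / 2)\<bar>)\<^sup>2"
    using abs_sin_mult_le[of n "\<theta> / 2"] by (metis abs_ge_zero power2_abs power_mono)
  then show ?thesis by (simp add: h power_mult_distrib)
qed

lemma fejer_bounds:
  assumes "0 \<le> w" "w \<le> 2"
  shows "0 \<le> poly (fejer n) w" "poly (fejer n) w \<le> (real n)\<^sup>2" "poly (fejer n) w * w \<le> 2"
proof -
  define \<theta> where "\<theta> = arccos (1 - w)"
  have w: "w = 1 - cos \<theta>" using assms by (simp add: \<theta>_def)
  have e: "poly (fejer n) w * w = 1 - cos (real n * \<theta>)" unfolding w by (rule fejer_cos)
  then show "poly (fejer n) w * w \<le> 2" by (smt (verit) cos_ge_minus_one)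
  show "0 \<le> poly (fejer n) w"
  proof (cases "w = 0")
    case False
    have "0 \<le> poly (fejer n) w * w" unfolding e by simp
    with False assms show ?thesis by (simp add: zero_le_mult_iff)
  qed (simp add: poly_fejer_0)
  show "poly (fejer n) w \<le> (real n)\<^sup>2"
  proof (cases "w = 0")
    case False
    have "poly (fejer n) w * w \<le> (real n)\<^sup>2 * w" 
      unfolding e using one_minus_cos_mult_le w by simp
    with False assms show ?thesis by simp
  qed (simp add: poly_fejer_0)
qed

text \<open>The first differences \<open>D n\<close> grow by 2 - 2 w F(n + 1) at each step, where
  F(n + 1) is at most (n + 1)^2; summing twice loses only O(w n^4). This measures how close the
  normalized kernel stays to 1 near w = 0, as needed to control P(0).\<close>

lemma fejer_ge:
  assumes "0 \<le> w" "w \<le> 2"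
  shows "(real n)\<^sup>2 - 2 * w * real n ^ 4 \<le> poly (fejer n) w"
proof -
  define D where "D n = poly (fejer (Suc n)) w - poly (fejer n) w" for n
  have D: "2 * real n + 1 - 2 * w * real n ^ 3 \<le> D n" for n
  proof (induction n)
    case (Suc n)
    have "D (Suc n) = D n + 2 - 2 * (w * poly (fejer (Suc n)) w)"
      unfolding D_def by (simp add: algebra_simps)
    moreover have "w * poly (fejer (Suc n)) w \<le> w * (real (Suc n))\<^sup>2"
      using fejer_bounds(2)[OF assms] assms by (intro mult_left_mono)
    moreover have "real n ^ 3 + (real (Suc n))\<^sup>2 \<le> real (Suc n) ^ 3"
      by (simp add: power2_eq_square power3_eq_cube algebra_simps)
    then have "w * (real n ^ 3 + (real (Suc n))\<^sup>2) \<le> w * (real (Suc n) ^ 3)"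
      using assms by (intro mult_left_mono)
    ultimately show ?case using Suc by (simp add: algebra_simps)
  qed (simp add: D_def)
  show ?thesis
  proof (induction n)
    case (Suc n)
    have "real n ^ 4 + real n ^ 3 \<le> real (Suc n) ^ 4"
      by (simp add: power4_eq_xxxx power3_eq_cube algebra_simps)
    then have "w * (real n ^ 4 + real n ^ 3) \<le> w * (real (Suc n) ^ 4)"
      using assms by (intro mult_left_mono)
    moreover have "poly (fejer (Suc n)) w = D n + poly (fejer n) w" by (simp add: D_def)
    ultimately show ?case using Suc D[of n] by (simp add: power2_eq_square algebra_simps)
  qed simp
qed

section \<open>Antiderivatives and the approximating polynomial\<close>

lemma pderiv_sum: "pderiv (sum f A) = (\<Sum>i\<in>A. pderiv (f i))"
  by (induction A rule: infinite_finite_induct) (auto simp: pderiv_add)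

lemma exists_poly_antiderivative:
  fixes p :: "real poly"
  shows "\<exists>q. pderiv q = p \<and> degree q \<le> Suc (degree p)"
proof (intro exI conjI)
  let ?q = "\<Sum>i\<le>degree p. monom (coeff p i / real (Suc i)) (Suc i)"
  have "pderiv ?q = (\<Sum>i\<le>degree p. monom (coeff p i) i)"
    using of_nat_neq_0 by (simp add: pderiv_sum pderiv_monom del: of_nat_Suc)
  then show "pderiv ?q = p" by (simp add: poly_as_sum_of_monoms)
  show "degree ?q \<le> Suc (degree p)"
    by (intro degree_sum_le) (auto intro: order_trans[OF degree_monom_le])
qed

text \<open>
  Integrating \<open>g' = - q / (2 w)\<close> from \<open>2\<close> turns decay of \<open>q\<close> into decay of \<open>g\<close>.
\<close>

lemma decay_from_derivative:
  fixes g q :: "real \<Rightarrow> real"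
  assumes der: "\<And>w. 0 < w \<Longrightarrow> (g has_real_derivative - (q w / (2 * w))) (at w)"
    and "g 2 = 0" and "a > 0" and "B \<ge> 0"
    and q: "\<And>w. 0 < w \<Longrightarrow> w \<le> 2 \<Longrightarrow> q w \<le> B * w powr - a"
    and w: "0 < w" "w \<le> 2"
  shows "g w \<le> B * w powr - a / (2 * a)"
proof -
  \<comment> \<open>The first term solves the equation of \<open>g\<close> with the bound
    \<open>B * w powr - a\<close> in place of \<open>q\<close>. Hence \<open>k\<close> is
    nonincreasing, and \<open>k 2\<close> is nonnegative.\<close>
  define k where "k w = B * w powr - a / (2 * a) - g w" for w
  have "k 2 \<le> k w"
  proof (rule DERIV_nonpos_imp_nonincreasing[OF w(2)])
    fix x assume x: "w \<le> x" "x \<le> 2"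
    then have x0: "0 < x" using w by simp
    have "(k has_real_derivative B * (- a * x powr (- a - 1)) / (2 * a) - (- (q x / (2 * x)))) (at x)"
      unfolding k_def using x0 assms(3)
      by (auto intro!: derivative_eq_intros der has_real_derivative_powr)
    moreover have "B * (- a * x powr (- a - 1)) / (2 * a) - (- (q x / (2 * x))) = (q x - B * x powr - a) / (2 * x)"
      using x0 assms(3) by (simp add: powr_diff field_simps)
    moreover have "(q x - B * x powr - a) / (2 * x) \<le> 0"
      using q[OF x0 x(2)] x0 by (simp add: divide_nonpos_pos)
    ultimately show "\<exists>y. DERIV k x :> y \<and> y \<le> 0" by auto
  qed
  moreover have "k 2 \<ge> 0" using assms by (simp add: k_def)
  ultimately show ?thesis by (simp add: k_def)
qed

text \<open>For w = |x - y|^2 / 2 both error bounds are powers of 2 / (n |x - y|). The first power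
  is mild enough to be integrated near the diagonal; the power 2 m gives fast decay beyond the scale
  1 / n.\<close>

lemma log_poly_approx:
  fixes m n :: nat
  assumes m: "m \<ge> 1" and n: "n \<ge> 1"
  obtains P :: "real poly" where "degree P \<le> m * (n - 1)"
    and "\<And>w. 0 < w \<Longrightarrow> w \<le> 2 \<Longrightarrow> poly P w \<le> - ln (2 * w) / 2"
    and "\<And>w. 0 < w \<Longrightarrow> w \<le> 2 \<Longrightarrow> - ln (2 * w) / 2 - poly P w \<le> 2 / (real n * sqrt (2 * w))"
    and "\<And>w. 0 < w \<Longrightarrow> w \<le> 2 \<Longrightarrow> - ln (2 * w) / 2 - poly P w \<le> (2 / (real n * sqrt (2 * w))) ^ (2 * m)"
    and "\<bar>poly P 0 - ln (real n)\<bar> \<le> 2 * real m + 2"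
proof -
  define q where "q = smult (1 / (real n)\<^sup>2) (fejer n)"
  define Q where "Q = q ^ m"
  have q01: "0 \<le> poly q w" "poly q w \<le> 1" "poly q w \<le> 2 / ((real n)\<^sup>2 * w)"
    and q_ge: "1 - 2 * w * (real n)\<^sup>2 \<le> poly q w" if "0 < w" "w \<le> 2" for w
    using fejer_bounds[of w n] fejer_ge[of w n] that n
    by (simp_all add: q_def field_simps power2_eq_square power4_eq_xxxx)
  have Q01: "0 \<le> poly Q w" "poly Q w \<le> 1" and Q_dec: "poly Q w \<le> (2 / ((real n)\<^sup>2 * w)) ^ m"
    and Q_half: "poly Q w \<le> sqrt (2 / ((real n)\<^sup>2 * w))"
    and Q_ge: "1 - poly Q w \<le> 2 * real m * w * (real n)\<^sup>2" if w: "0 < w" "w \<le> 2" for w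
  proof -
    have Qq: "poly Q w = poly q w ^ m" by (simp add: Q_def)
    show 1: "0 \<le> poly Q w" "poly Q w \<le> 1" using q01[OF w] by (auto simp: Qq power_le_one)
    show "poly Q w \<le> (2 / ((real n)\<^sup>2 * w)) ^ m" unfolding Qq using q01[OF w] by (intro power_mono) auto
    \<comment> \<open>The square root is a deliberate weakening: \<open>q\<close> decays like 1 /
      (n^2 w), and half of this exponent yields the first-power bound.\<close>
    have "poly Q w \<le> poly q w"
      using power_decreasing[of 1 m "poly q w"] m q01[OF w] by (simp add: Qq)
    also have "\<dots> \<le> sqrt (poly q w)"
      using q01(1,2)[OF w] by (intro real_le_rsqrt) (simp add: power2_eq_square mult_left_le)
    also have "\<dots> \<le> sqrt (2 / ((real n)\<^sup>2 * w))" using q01[OF w] by simp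
    finally show "poly Q w \<le> sqrt (2 / ((real n)\<^sup>2 * w))" .
    \<comment> \<open>Bernoulli bounds 1 - q^m by m (1 - q), which carries \<open>fejer_ge\<close>
      over to \<open>Q\<close>.\<close>
    have "1 + real m * (poly q w - 1) \<le> (1 + (poly q w - 1)) ^ m"
      using q01[OF w] by (intro Bernoulli_inequality) auto
    moreover have "real m * (1 - poly q w) \<le> real m * (2 * w * (real n)\<^sup>2)"
      using q_ge[OF w] by (intro mult_left_mono) auto
    ultimately show "1 - poly Q w \<le> 2 * real m * w * (real n)\<^sup>2" unfolding Qq
      by (simp add: algebra_simps)
  qed
  \<comment> \<open>Divisibility by w makes R = (1 - Q) / w a polynomial, so that - R / 2 can serve
    as the derivative of \<open>P\<close>.\<close>
  have "poly (1 - Q) 0 = 0" using n by (simp add: Q_def q_def poly_fejer_0)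
  then obtain R where R: "1 - Q = [:0, 1:] * R"
    using poly_eq_0_iff_dvd[of "1 - Q" 0] by (auto elim: dvdE)
  have degQ: "degree (1 - Q) \<le> m * (n - 1)"
  proof -
    have "degree Q \<le> degree q * m" unfolding Q_def by (rule degree_power_le)
    also have "\<dots> \<le> (n - 1) * m" using degree_fejer[of n] by (auto simp: q_def)
    finally show ?thesis by (intro degree_diff_le) (auto simp: mult.commute)
  qed
  obtain P0 where P0: "pderiv P0 = smult (-1/2) R" "degree P0 \<le> Suc (degree (smult (-1/2) R))"
    using exists_poly_antiderivative by blast
  define P where "P = P0 + [:- ln 4 / 2 - poly P0 2:] "
  have dP: "pderiv P = smult (-1/2) R" by (simp add: P_def pderiv_add P0(1) pderiv_pCons)
  have degP: "degree P \<le> m * (n - 1)"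
  proof (cases "R = 0")
    case True
    then have "degree P = 0" using dP by (simp add: pderiv_eq_0_iff)
    then show ?thesis by simp
  next
    case False
    have "degree (1 - Q) = Suc (degree R)" unfolding R using False by (subst degree_mult_eq) auto
    then have "degree P0 \<le> m * (n - 1)" using P0(2) degQ by simp
    then show ?thesis unfolding P_def by (intro degree_add_le) auto
  qed
  have Rw: "poly R w = (1 - poly Q w) / w" if "w > 0" for w
    using arg_cong[OF R, of "\<lambda>p. poly p w"] that by (simp add: field_simps)
  define g where "g w = - ln (2 * w) / 2 - poly P w" for w
  have der: "(g has_real_derivative - (poly Q w / (2 * w))) (at w)" if "w > 0" for w
  proof -
    have "(g has_real_derivative - (1 / (2 * w) * 2) / 2 - poly (pderiv P) w) (at w)"
      unfolding g_def using that by (auto intro!: derivative_eq_intros poly_DERIV)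
    then show ?thesis using that by (simp add: dP Rw field_simps)
  qed
  have g2: "g 2 = 0" by (simp add: g_def P_def)
  have gpos: "0 \<le> g w" if "0 < w" "w \<le> 2" for w
  proof -
    have "g 2 \<le> g w"
    proof (rule DERIV_nonpos_imp_nonincreasing[OF that(2)])
      fix x assume x: "w \<le> x" "x \<le> 2"
      then have x0: "0 < x" using that by simp
      show "\<exists>y. DERIV g x :> y \<and> y \<le> 0"
        using der[OF x0] Q01[OF x0 x(2)] x0 by (auto intro!: exI divide_nonpos_pos)
    qed
    then show ?thesis by (simp add: g2)
  qed
  \<comment> \<open>Each bound becomes a constant times a power of w; the exponents 1/2 and m are
    the two values of \<open>a\<close> used with \<open>decay_from_derivative\<close>.\<close>
  have s: "2 / (real n * sqrt (2 * w)) = sqrt (2 / (real n)\<^sup>2) * w powr - (1/2)"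
    "(2 / (real n * sqrt (2 * w))) ^ (2 * m) = (2 / (real n)\<^sup>2) ^ m * w powr - real m"
    "sqrt (2 / ((real n)\<^sup>2 * w)) = sqrt (2 / (real n)\<^sup>2) * w powr - (1/2)"
    "(2 / ((real n)\<^sup>2 * w)) ^ m = (2 / (real n)\<^sup>2) ^ m * w powr - real m"
    if "w > 0" for w
  proof -
    have e: "w powr - (1/2) = 1 / sqrt w" "w powr - real m = 1 / w ^ m"
      using that by (auto simp: powr_minus powr_half_sqrt powr_realpow field_simps)
    have "2 / sqrt 2 = sqrt 2" by (simp add: real_div_sqrt)
    then show "2 / (real n * sqrt (2 * w)) = sqrt (2 / (real n)\<^sup>2) * w powr - (1/2)"
      unfolding e using that n by (simp add: real_sqrt_mult real_sqrt_divide field_simps)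
    have "(2 / (real n * sqrt (2 * w))) ^ (2 * m) = ((2 / (real n)\<^sup>2) * (1 / w)) ^ m"
      using that by (simp add: power_mult power_divide power_mult_distrib)
    then show "(2 / (real n * sqrt (2 * w))) ^ (2 * m) = (2 / (real n)\<^sup>2) ^ m * w powr - real m"
      unfolding e by (simp only: power_mult_distrib power_one_over)
    show "sqrt (2 / ((real n)\<^sup>2 * w)) = sqrt (2 / (real n)\<^sup>2) * w powr - (1/2)"
      unfolding e by (simp add: real_sqrt_mult real_sqrt_divide)
    show "(2 / ((real n)\<^sup>2 * w)) ^ m = (2 / (real n)\<^sup>2) ^ m * w powr - real m"
      unfolding e by (simp add: power_divide power_mult_distrib)
  qed
  have g1: "g w \<le> 2 / (real n * sqrt (2 * w))" if w: "0 < w" "w \<le> 2" for w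
  proof -
    have "g w \<le> sqrt (2 / (real n)\<^sup>2) * w powr - (1/2) / (2 * (1/2))"
      by (rule decay_from_derivative[where q = "poly Q"])
        (use der g2 w Q_half s(3) in auto)
    then show ?thesis using s(1)[OF w(1)] by simp
  qed
  have gm: "g w \<le> (2 / (real n * sqrt (2 * w))) ^ (2 * m) / (2 * real m)" if w: "0 < w" "w \<le> 2" for w
  proof -
    have "g w \<le> (2 / (real n)\<^sup>2) ^ m * w powr - real m / (2 * real m)"
      by (rule decay_from_derivative[where q = "poly Q"])
        (use der g2 w m Q_dec s(4) in auto)
    then show ?thesis using s(2)[OF w(1)] by simp
  qed
  \<comment> \<open>At w = v the first error bound equals 1 and - ln (2 v) / 2 = ln n - ln 2, so
    P(v) is ln n up to a bounded error.\<close>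
  define v where "v = 2 / (real n)\<^sup>2"
  have v: "0 < v" "v \<le> 2" using n by (auto simp: v_def field_simps)
  have "sqrt (2 * v) = 2 / real n"
    by (simp add: v_def real_sqrt_divide)
  then have nv: "real n * sqrt (2 * v) = 2" using n by simp
  have gv: "0 \<le> g v" "g v \<le> 1" using gpos[OF v] g1[OF v] nv by auto
  have "ln (2 * v) = ln ((2 / real n)\<^sup>2)" by (simp add: v_def power2_eq_square)
  also have "\<dots> = 2 * (ln 2 - ln (real n))" using n by (simp add: ln_realpow ln_div)
  finally have "- ln (2 * v) / 2 = ln (real n) - ln 2" by (simp add: diff_divide_distrib)
  then have Pv: "poly P v = ln (real n) - ln 2 - g v" unfolding g_def by linarith
  \<comment> \<open>Between 0 and v the derivative - R / 2 is at most m n^2 in absolute value by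
    \<open>Q_ge\<close>, so the mean value theorem costs at most v m n^2 = 2 m.\<close>
  have P0v: "\<exists>z>0. z < v \<and> poly P v - poly P 0 = (v - 0) * poly (pderiv P) z"
    using poly_MVT[OF v(1), of P] by auto
  then obtain z where z: "0 < z" "z < v" "poly P 0 = poly P v + v * (poly R z / 2)"
    by (auto simp: dP)
  have "0 \<le> poly R z" "poly R z \<le> 2 * real m * (real n)\<^sup>2"
    using Q_ge[of z] Q01[of z] z v by (auto simp: Rw field_simps)
  then have "0 \<le> v * (poly R z / 2)" "v * (poly R z / 2) \<le> v * (real m * (real n)\<^sup>2)"
    using v(1) by (auto intro!: mult_nonneg_nonneg)
  moreover have "v * (real m * (real n)\<^sup>2) = 2 * real m" using n by (simp add: v_def)
  moreover have "0 \<le> ln (2::real)" "ln (2::real) \<le> 1" using ln_le_minus_one[of "2::real"] by auto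
  ultimately have c: "\<bar>poly P 0 - ln (real n)\<bar> \<le> 2 * real m + 2" using z(3) Pv gv by linarith
  show thesis
  proof (rule that[OF degP _ _ _ c])
    fix w :: real assume w: "0 < w" "w \<le> 2"
    show "poly P w \<le> - ln (2 * w) / 2" using gpos[OF w] by (simp add: g_def)
    show "- ln (2 * w) / 2 - poly P w \<le> 2 / (real n * sqrt (2 * w))" using g1[OF w] by (simp add: g_def)
    have "(2 / (real n * sqrt (2 * w))) ^ (2 * m) / (2 * real m) \<le> (2 / (real n * sqrt (2 * w))) ^ (2 * m) / 1"
      using m w by (intro divide_left_mono) auto
    then show "- ln (2 * w) / 2 - poly P w \<le> (2 / (real n * sqrt (2 * w))) ^ (2 * m)"
      using gm[OF w] by (simp add: g_def)
  qed
qed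

subsection \<open>Caps, separated sets and decaying kernels\<close>

text \<open>Dyadic decomposition by the size of \<open>s\<close>. Where s is about 2^(-j), h is at
  most 2^(j+1) on mass at most A 2^(-j e), summable since e \<ge> 2. Where s is about 2^j, h is at
  most 2^(-j k) on mass at most A 2^((j+1) e), summable since k > e. The abstract measure lets one
  estimate serve both the surface measure and the counting measure.\<close>

lemma nn_integral_decay_le:
  fixes s h :: "'a \<Rightarrow> real"
  assumes [measurable]: "s \<in> borel_measurable M"
    and pos: "AE x in M. 0 < s x"
    and growth: "\<And>r. 0 < r \<Longrightarrow> emeasure M {x \<in> space M. s x \<le> r} \<le> ennreal (A * r ^ e)"
    and "A \<ge> 0" and e: "2 \<le> e" "e < k"
    and h: "AE x in M. h x \<le> 1 / s x \<and> h x \<le> (1 / s x) ^ k"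
  shows "(\<integral>\<^sup>+x. ennreal (h x) \<partial>M) \<le> ennreal (A * (4 + 2 ^ Suc e))"
proof -
  define S where "S r = {x \<in> space M. s x \<le> r}" for r
  have [measurable]: "S r \<in> sets M" for r unfolding S_def by measurable
  \<comment> \<open>One term per scale, with whole sublevel sets instead of shells; it suffices that
    each point has a single \<open>j\<close> with \<open>h x\<close> below
    \<open>F j x\<close>.\<close>
  define F where "F j x = ennreal (2 ^ Suc j) * indicator (S ((1/2) ^ j)) x
    + ennreal ((1/2) ^ (j * k)) * indicator (S (2 ^ Suc j)) x" for j :: nat and x
  have "AE x in M. ennreal (h x) \<le> (\<Sum>j. F j x)"
    using pos h AE_space
  proof eventually_elim
    case (elim x)
    have "\<exists>j. ennreal (h x) \<le> F j x"
    proof (cases "s x \<le> 1")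
      case True
      \<comment> \<open>The least index places \<open>s x\<close> between 2^(-j-1) and 2^(-j); for j
        = 0 the upper bound is the case assumption.\<close>
      define j where "j = (LEAST j. (1/2) ^ Suc j < s x)"
      obtain i where "(1/2 :: real) ^ i < s x" using real_arch_pow_inv[of "s x" "1/2"] elim by auto
      moreover have "(1/2 :: real) ^ Suc i \<le> (1/2) ^ i" by simp
      ultimately have "(1/2) ^ Suc i < s x" by linarith
      then have 1: "(1/2) ^ Suc j < s x" unfolding j_def by (rule LeastI)
      have 2: "s x \<le> (1/2) ^ j"
      proof (cases j)
        case 0 then show ?thesis using True by simp
      next
        case (Suc i)
        have "\<not> (1/2) ^ Suc i < s x" using not_less_Least[of i "\<lambda>j. (1/2) ^ Suc j < s x"] Suc
          unfolding j_def by auto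
        then show ?thesis using Suc by simp
      qed
      have "h x \<le> 1 / s x" using elim by simp
      also have "\<dots> \<le> 1 / (1/2) ^ Suc j" using 1 elim by (intro divide_left_mono) auto
      also have "\<dots> = 2 ^ Suc j" by (simp add: power_divide)
      finally have "ennreal (h x) \<le> F j x" unfolding F_def using 2 elim
        by (auto simp: S_def intro!: add_increasing2 ennreal_leI)
      then show ?thesis ..
    next
      case False
      define j where "j = (LEAST j. s x \<le> 2 ^ Suc j)"
      obtain i where "s x < (2 :: real) ^ i" using real_arch_pow[of 2 "s x"] by auto
      moreover have "(2 :: real) ^ i \<le> 2 ^ Suc i" by simp
      ultimately have "s x \<le> 2 ^ Suc i" by linarith
      then have 1: "s x \<le> 2 ^ Suc j" unfolding j_def by (rule LeastI)
      have 2: "2 ^ j \<le> s x"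
      proof (cases j)
        case 0 then show ?thesis using False by simp
      next
        case (Suc i)
        have "\<not> s x \<le> 2 ^ Suc i" using not_less_Least[of i "\<lambda>j. s x \<le> 2 ^ Suc j"] Suc
          unfolding j_def by auto
        then show ?thesis using Suc by simp
      qed
      have "h x \<le> (1 / s x) ^ k" using elim by simp
      also have "\<dots> \<le> (1 / 2 ^ j) ^ k" using 2 elim by (intro power_mono divide_left_mono) auto
      also have "\<dots> = (1/2) ^ (j * k)" by (simp add: power_divide power_mult)
      finally have "ennreal (h x) \<le> F j x" unfolding F_def using 1 elim
        by (auto simp: S_def intro!: add_increasing ennreal_leI)
      then show ?thesis ..
    qed
    then obtain j where "ennreal (h x) \<le> F j x" ..
    also have "\<dots> \<le> (\<Sum>j. F j x)" using sum_le_suminf[of "\<lambda>j. F j x" "{j}"] by simp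
    finally show ?case .
  qed
  then have "(\<integral>\<^sup>+x. ennreal (h x) \<partial>M) \<le> (\<integral>\<^sup>+x. (\<Sum>j. F j x) \<partial>M)"
    by (rule nn_integral_mono_AE)
  also have "\<dots> = (\<Sum>j. \<integral>\<^sup>+x. F j x \<partial>M)"
    unfolding F_def by (intro nn_integral_suminf) measurable
  also have "\<dots> \<le> (\<Sum>j. ennreal (A * (2 + 2 ^ e) * (1/2) ^ j))"
  proof (intro suminf_le)
    fix j
    have "(\<integral>\<^sup>+x. F j x \<partial>M) = ennreal (2 ^ Suc j) * emeasure M (S ((1/2) ^ j))
        + ennreal ((1/2) ^ (j * k)) * emeasure M (S (2 ^ Suc j))"
      unfolding F_def by (subst nn_integral_add) (auto simp: nn_integral_cmult_indicator)
    also have "\<dots> \<le> ennreal (2 ^ Suc j) * ennreal (A * ((1/2) ^ j) ^ e)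
        + ennreal ((1/2) ^ (j * k)) * ennreal (A * (2 ^ Suc j) ^ e)"
      unfolding S_def by (intro add_mono mult_left_mono growth) auto
    also have "\<dots> = ennreal (A * (2 ^ Suc j * ((1/2) ^ j) ^ e + (1/2) ^ (j * k) * (2 ^ Suc j) ^ e))"
      using \<open>A \<ge> 0\<close> by (simp add: ennreal_mult[symmetric] ennreal_plus[symmetric] algebra_simps
          del: ennreal_plus)
    also have "\<dots> \<le> ennreal (A * (2 * (1/2) ^ j + 2 ^ e * (1/2) ^ j))"
    proof (intro ennreal_leI mult_left_mono add_mono)
      have "2 ^ Suc j * ((1/2) ^ j) ^ e \<le> 2 ^ Suc j * ((1/2 :: real) ^ j) ^ 2"
        using e by (intro mult_left_mono power_decreasing) (auto simp: power_le_one)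
      also have "\<dots> = 2 * (1/2) ^ j"
        by (simp add: power2_eq_square power_divide)
      finally show "2 ^ Suc j * ((1/2) ^ j) ^ e \<le> 2 * (1/2 :: real) ^ j" .
      have "(1/2) ^ (j * k) * (2 ^ Suc j) ^ e = 2 ^ e * (1/2 :: real) ^ (j * (k - e))"
      proof -
        have "j * k = j * (k - e) + j * e" using e by (simp flip: distrib_left)
        then show ?thesis by (simp add: power_add power_mult power_mult_distrib power_divide)
      qed
      also have "\<dots> \<le> 2 ^ e * (1/2) ^ j"
        using e by (intro mult_left_mono power_decreasing) auto
      finally show "(1/2) ^ (j * k) * (2 ^ Suc j) ^ e \<le> 2 ^ e * (1/2 :: real) ^ j" .
    qed (use \<open>A \<ge> 0\<close> in auto)
    finally show "(\<integral>\<^sup>+x. F j x \<partial>M) \<le> ennreal (A * (2 + 2 ^ e) * (1/2) ^ j)"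
      by (simp add: algebra_simps)
  qed auto
  also have "\<dots> = ennreal (A * (2 + 2 ^ e) * 2)"
  proof (rule suminf_ennreal_eq)
    have "(\<lambda>j. (1/2 :: real) ^ j) sums 2" using geometric_sums[of "1/2 :: real"] by simp
    then show "(\<lambda>j. A * (2 + 2 ^ e) * (1/2) ^ j) sums (A * (2 + 2 ^ e) * 2)" by (rule sums_mult)
  qed (use \<open>A \<ge> 0\<close> in auto)
  finally show ?thesis by (simp add: algebra_simps)
qed

section \<open>Mass of the sphere and of its caps\<close>

lemma sets_sphere_measure: "sets (sphere_measure :: (real ^ 'n) measure) = sets (restrict_space borel (sphere 0 1))"
  unfolding sphere_measure_def by (rule sets_restrict_space_cong) simp

lemma borel_measurable_sphere_measure:
  "f \<in> borel_measurable borel \<Longrightarrow> f \<in> borel_measurable (sphere_measure :: (real ^ 'n) measure)"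
  by (subst measurable_cong_sets[OF sets_sphere_measure refl]) (rule measurable_restrict_space1)

lemma emeasure_sphere_measure_sphere: "emeasure sphere_measure (sphere 0 1 :: (real ^ 'n) set) = 1"
proof -
  let ?B = "cball 0 1 :: (real ^ 'n) set"
  have cone: "{r *\<^sub>R x |r x. 0 < r \<and> r \<le> 1 \<and> x \<in> sphere 0 1} = ?B - {0}" 
  proof (intro equalityI subsetI)
    fix z assume "z \<in> ?B - {0}"
    then have "z = norm z *\<^sub>R (z /\<^sub>R norm z)" "0 < norm z" "norm z \<le> 1" "z /\<^sub>R norm z \<in> sphere 0 1"
      by auto
    then show "z \<in> {r *\<^sub>R x |r x. 0 < r \<and> r \<le> 1 \<and> x \<in> sphere 0 1}" by blast
  qed auto
  have "emeasure sphere_measure (sphere 0 1 :: (real ^ 'n) set) = emeasure lborel (?B - {0}) / emeasure lborel ?B"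
    by (subst emeasure_sphere_measure) (simp_all only: cone borel_closed closed_sphere order_refl)
  also have "emeasure lborel (?B - {0}) = emeasure lborel ?B"
    by (rule emeasure_Diff_null_set) auto
  also have "emeasure lborel ?B / emeasure lborel ?B = 1"
    by (rule ennreal_divide_self)
      (use unit_ball_vol_pos[of "real CARD('n)"] in \<open>auto simp: emeasure_cball simp del: unit_ball_vol_pos\<close>)
  finally show ?thesis .
qed

lemma finite_measure_sphere_measure: "finite_measure (sphere_measure :: (real ^ 'n) measure)"
  by (rule finite_measureI) (simp add: space_sphere_measure emeasure_sphere_measure_sphere)

text \<open>The cone over a cap of radius \<open>r\<close> is covered by \<open>1 / r + 1\<close> balls of radius \<open>2 r\<close>
  centred on the axis.\<close>

lemma emeasure_spherical_cap_le:
  fixes x :: "real ^ 'n"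
  assumes d: "CARD('n) = d + 1" and x: "norm x = 1" and r: "0 < r"
  shows "emeasure sphere_measure {y \<in> sphere 0 1. norm (x - y) \<le> r} \<le> ennreal (2 ^ (d + 3) * r ^ d)"
proof (cases "r \<le> 1")
  case False
  have "emeasure sphere_measure {y \<in> sphere 0 1. norm (x - y) \<le> r} \<le> 1"
    using emeasure_space[of sphere_measure] by (metis emeasure_sphere_measure_sphere space_sphere_measure)
  also have "1 = ennreal (1 * 1)" by simp
  also have "\<dots> \<le> ennreal (2 ^ (d + 3) * r ^ d)"
    using False by (intro ennreal_leI mult_mono one_le_power) auto
  finally show ?thesis .
next
  case True
  let ?C = "{y \<in> sphere 0 1. norm (x - y) \<le> r}"
  define K where "K = nat \<lfloor>1 / r\<rfloor>"
  define v where "v = unit_ball_vol (real CARD('n))"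
  have v: "v > 0" by (simp add: v_def)
  have K: "real (Suc K) \<le> 2 / r"
  proof -
    have "real K \<le> 1 / r" unfolding K_def using r by (intro of_nat_floor) simp
    moreover have "1 \<le> 1 / r" using r True by simp
    moreover have "1 / r + 1 / r = 2 / r" by simp
    ultimately show ?thesis unfolding of_nat_Suc by linarith
  qed
  have C: "?C \<in> sets borel" by measurable
  have cover: "{t *\<^sub>R y |t y. 0 < t \<and> t \<le> 1 \<and> y \<in> ?C} \<subseteq> (\<Union>k\<le>K. cball ((real k * r) *\<^sub>R x) (2 * r))"
  proof clarsimp
    fix t :: real and y :: "real ^ 'n" assume t: "0 < t" "t \<le> 1" and y: "norm y = 1" "norm (x - y) \<le> r"
    \<comment> \<open>k r is the largest multiple of r not above t. The distance then splits into
      the rounding error and t |x - y|, each at most r.\<close>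
    define k where "k = nat \<lfloor>t / r\<rfloor>"
    have kK: "k \<le> K" unfolding k_def K_def using t r by (intro nat_mono floor_mono divide_right_mono) auto
    have "\<bar>real k - t / r\<bar> \<le> 1"
      unfolding k_def using t r by (simp add: abs_le_iff) linarith
    then have k: "\<bar>real k * r - t\<bar> \<le> r" 
      using r by (simp add: abs_le_iff field_simps)
    have "dist ((real k * r) *\<^sub>R x) (t *\<^sub>R y) = norm ((real k * r - t) *\<^sub>R x + t *\<^sub>R (x - y))"
      by (simp add: dist_norm algebra_simps)
    also have "\<dots> \<le> \<bar>real k * r - t\<bar> + t * norm (x - y)"
      using norm_triangle_ineq[of "(real k * r - t) *\<^sub>R x" "t *\<^sub>R (x - y)"] x t by simp
    also have "\<dots> \<le> r + 1 * r" using k t y by (intro add_mono mult_mono) auto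
    finally have "dist ((real k * r) *\<^sub>R x) (t *\<^sub>R y) \<le> 2 * r" by simp
    then show "\<exists>k\<in>{..K}. dist ((real k * r) *\<^sub>R x) (t *\<^sub>R y) \<le> 2 * r" using kK by blast
  qed
  have "emeasure lborel {t *\<^sub>R y |t y. 0 < t \<and> t \<le> 1 \<and> y \<in> ?C}
      \<le> emeasure lborel (\<Union>k\<le>K. cball ((real k * r) *\<^sub>R x) (2 * r))"
    using cover by (intro emeasure_mono) auto
  also have "\<dots> \<le> (\<Sum>k\<le>K. emeasure lborel (cball ((real k * r) *\<^sub>R x) (2 * r)))"
    by (intro emeasure_subadditive_finite) auto
  also have "\<dots> = ennreal (real (Suc K) * (v * (2 * r) ^ (d + 1)))"
    unfolding d[symmetric] using r v
    by (simp add: emeasure_cball v_def ennreal_mult[symmetric] ennreal_of_nat_eq_real_of_nat del: of_nat_Suc)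
  also have "\<dots> \<le> ennreal (2 / r * (v * (2 * r) ^ (d + 1)))"
    using K v r by (intro ennreal_leI mult_right_mono) auto
  \<comment> \<open>The number of balls costs one factor 1 / r, which lowers the ambient exponent d
    + 1 to d; \<open>v\<close> cancels against the volume of the unit ball.\<close>
  also have "2 / r * (v * (2 * r) ^ (d + 1)) = v * (2 ^ (d + 2) * r ^ d)"
    using r by (simp add: power_mult_distrib)
  finally have "emeasure sphere_measure ?C \<le> ennreal (v * (2 ^ (d + 2) * r ^ d)) / ennreal v"
    using C by (subst emeasure_sphere_measure) (auto simp: emeasure_cball v_def intro!: divide_right_mono_ennreal)
  also have "\<dots> = ennreal (2 ^ (d + 2) * r ^ d)"
    using v r by (subst divide_ennreal) auto
  also have "\<dots> \<le> ennreal (2 ^ (d + 3) * r ^ d)"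
    using r by (intro ennreal_leI mult_right_mono) (auto simp: power_add)
  finally show ?thesis .
qed

text \<open>Disjoint balls of radius \<open>\<delta> / 2\<close>, compared by volume in the ambient space.\<close>

lemma card_separated_le:
  fixes X :: "(real ^ 'n) set"
  assumes "finite X" "0 < \<delta>" "0 < r" and x: "x \<in> X"
    and sep: "\<And>y z. y \<in> X \<Longrightarrow> z \<in> X \<Longrightarrow> y \<noteq> z \<Longrightarrow> \<delta> < norm (y - z)"
  shows "real (card {y \<in> X - {x}. norm (x - y) \<le> r}) \<le> (3 * r / \<delta>) ^ CARD('n)"
proof (cases "r < \<delta>")
  case True
  then have "{y \<in> X - {x}. norm (x - y) \<le> r} = {}" using sep[OF x] by fastforce
  then show ?thesis using assms by (simp del: Collect_empty_eq)
next
  case False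
  define Y where "Y = {y \<in> X - {x}. norm (x - y) \<le> r}"
  define v where "v = unit_ball_vol (real CARD('n))"
  have v: "v > 0" by (simp add: v_def)
  have Y: "finite Y" using assms(1) by (simp add: Y_def)
  have disj: "disjoint_family_on (\<lambda>y. cball y (\<delta> / 2)) Y"
  proof (clarsimp simp: disjoint_family_on_def disjoint_iff)
    fix y z u assume "y \<in> Y" "z \<in> Y" "y \<noteq> z" "dist y u * 2 \<le> \<delta>" "dist z u * 2 \<le> \<delta>"
    moreover from this have "\<delta> < dist y z" using sep[of y z] by (simp add: Y_def dist_norm)
    ultimately show False using dist_triangle2[of y z u] by linarith
  qed
  have "ennreal (real (card Y) * (v * (\<delta> / 2) ^ CARD('n))) = (\<Sum>y\<in>Y. emeasure lborel (cball y (\<delta> / 2)))"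
    using assms v by (simp add: emeasure_cball v_def ennreal_mult[symmetric] ennreal_of_nat_eq_real_of_nat)
  also have "\<dots> = emeasure lborel (\<Union>y\<in>Y. cball y (\<delta> / 2))"
    using disj Y by (intro sum_emeasure) auto
  also have "\<dots> \<le> emeasure lborel (cball x (r + \<delta> / 2))"
  proof (intro emeasure_mono subsetI)
    fix u assume "u \<in> (\<Union>y\<in>Y. cball y (\<delta> / 2))"
    then obtain y where "norm (x - y) \<le> r" "dist y u \<le> \<delta> / 2" by (auto simp: Y_def)
    then show "u \<in> cball x (r + \<delta> / 2)" using dist_triangle[of x u y] by (simp add: dist_norm)
  qed auto
  also have "\<dots> = ennreal (v * (r + \<delta> / 2) ^ CARD('n))"
    using assms by (simp add: emeasure_cball v_def)
  finally have "real (card Y) * (v * (\<delta> / 2) ^ CARD('n)) \<le> v * (r + \<delta> / 2) ^ CARD('n)"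
    using v assms by simp
  then have "real (card Y) * (\<delta> / 2) ^ CARD('n) \<le> (r + \<delta> / 2) ^ CARD('n)"
    using v by (simp add: mult.left_commute[of _ v] del: power_divide)
  then have "real (card Y) \<le> (r + \<delta> / 2) ^ CARD('n) / (\<delta> / 2) ^ CARD('n)"
    using assms by (subst pos_le_divide_eq) simp_all
  also have "\<dots> = ((r + \<delta> / 2) / (\<delta> / 2)) ^ CARD('n)" by (simp only: power_divide)
  \<comment> \<open>The quotient is 2 r / \<delta> + 1, and \<delta> \<le> r in this case.\<close>
  also have "\<dots> \<le> (3 * r / \<delta>) ^ CARD('n)"
    using False assms by (intro power_mono) (auto simp: field_simps)
  finally show ?thesis by (simp add: Y_def)
qed

subsection \<open>Zonal polynomials\<close>

lemma polynomials_uptoI: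
  assumes "\<And>x. p x = (\<Sum>\<alpha> | sum \<alpha> UNIV \<le> t. c \<alpha> * (\<Prod>i\<in>UNIV. (x $ i) ^ \<alpha> i))"
  shows "p \<in> (polynomials_upto t :: (real ^ 'n \<Rightarrow> real) set)"
  unfolding polynomials_upto_def using assms by (intro CollectI exI[of _ c] ext)

lemma polynomials_upto_mono: "s \<le> t \<Longrightarrow> p \<in> polynomials_upto s \<Longrightarrow> p \<in> (polynomials_upto t :: (real ^ 'n \<Rightarrow> real) set)"
proof -
  assume st: "s \<le> t" and "p \<in> polynomials_upto s"
  then obtain c where p: "p = (\<lambda>x. \<Sum>\<alpha> | sum \<alpha> UNIV \<le> s. c \<alpha> * (\<Prod>i\<in>UNIV. (x $ i) ^ \<alpha> i))"
    by (auto simp: polynomials_upto_def)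
  show "p \<in> polynomials_upto t"
    unfolding p using st
    by (intro polynomials_uptoI[where c = "\<lambda>\<alpha>. if sum \<alpha> UNIV \<le> s then c \<alpha> else 0"]
        sum.mono_neutral_cong_left finite_exponents) auto
qed

lemma monomial_in_polynomials_upto:
  fixes \<beta> :: "'n::finite \<Rightarrow> nat"
  assumes "sum \<beta> UNIV \<le> t"
  shows "(\<lambda>x. c * (\<Prod>i\<in>UNIV. (x $ i) ^ \<beta> i)) \<in> polynomials_upto t"
  using assms
  by (intro polynomials_uptoI[where c = "\<lambda>\<alpha>. if \<alpha> = \<beta> then c else 0"])
    (simp add: if_distrib[of "\<lambda>u. u * _"] finite_exponents sum.delta cong: if_cong)

lemma polynomials_upto_const: "(\<lambda>x :: real ^ 'n. c) \<in> polynomials_upto t"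
  using monomial_in_polynomials_upto[of "\<lambda>_. 0" t c] by simp

lemma polynomials_upto_add:
  assumes "p \<in> polynomials_upto t" "q \<in> polynomials_upto t"
  shows "(\<lambda>x. p x + q x) \<in> (polynomials_upto t :: (real ^ 'n \<Rightarrow> real) set)"
proof -
  obtain a where a: "p = (\<lambda>x. \<Sum>\<alpha> | sum \<alpha> UNIV \<le> t. a \<alpha> * (\<Prod>i\<in>UNIV. (x $ i) ^ \<alpha> i))"
    using assms(1) by (auto simp: polynomials_upto_def)
  obtain b where b: "q = (\<lambda>x. \<Sum>\<alpha> | sum \<alpha> UNIV \<le> t. b \<alpha> * (\<Prod>i\<in>UNIV. (x $ i) ^ \<alpha> i))"
    using assms(2) by (auto simp: polynomials_upto_def)
  show ?thesis unfolding polynomials_upto_def a b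
    by (intro CollectI exI[of _ "\<lambda>\<alpha>. a \<alpha> + b \<alpha>"]) (simp add: distrib_right sum.distrib)
qed

lemma polynomials_upto_sum:
  assumes "\<And>i. i \<in> I \<Longrightarrow> p i \<in> polynomials_upto t"
  shows "(\<lambda>x. \<Sum>i\<in>I. p i x) \<in> (polynomials_upto t :: (real ^ 'n \<Rightarrow> real) set)"
  using assms
  by (induction I rule: infinite_finite_induct) (auto intro: polynomials_upto_const polynomials_upto_add)

lemma polynomials_upto_mult_monomial:
  fixes \<beta> :: "'n::finite \<Rightarrow> nat"
  assumes "p \<in> polynomials_upto s" "s + sum \<beta> UNIV \<le> t"
  shows "(\<lambda>x. (c * (\<Prod>i\<in>UNIV. (x $ i) ^ \<beta> i)) * p x) \<in> polynomials_upto t"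
proof -
  obtain a where a: "p = (\<lambda>x. \<Sum>\<alpha> | sum \<alpha> UNIV \<le> s. a \<alpha> * (\<Prod>i\<in>UNIV. (x $ i) ^ \<alpha> i))"
    using assms(1) by (auto simp: polynomials_upto_def)
  have "(\<lambda>x. (c * (\<Prod>i\<in>UNIV. (x $ i) ^ \<beta> i)) * p x)
      = (\<lambda>x. \<Sum>\<alpha> | sum \<alpha> UNIV \<le> s. (c * a \<alpha>) * (\<Prod>i\<in>UNIV. (x $ i) ^ (\<alpha> i + \<beta> i)))"
    unfolding a by (simp add: sum_distrib_left power_add prod.distrib mult_ac)
  also have "\<dots> \<in> polynomials_upto t"
    using assms(2) by (intro polynomials_upto_sum monomial_in_polynomials_upto) (auto simp: sum.distrib)
  finally show ?thesis .
qed

lemma polynomials_upto_mult_inner: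
  assumes "p \<in> polynomials_upto t"
  shows "(\<lambda>y. inner x y * p y) \<in> (polynomials_upto (Suc t) :: (real ^ 'n \<Rightarrow> real) set)"
proof -
  have *: "(\<Prod>i\<in>UNIV. (y $ i) ^ (if i = j then 1 else 0)) = y $ j" for y :: "real ^ 'n" and j
    by (simp add: if_distrib[of "\<lambda>k. _ ^ k"] prod.delta cong: if_cong)
  have "(\<lambda>y. x $ j * (\<Prod>i\<in>UNIV. (y $ i) ^ (if i = j then 1 else 0)) * p y) \<in> polynomials_upto (Suc t)" for j
    using assms by (intro polynomials_upto_mult_monomial[where s = t]) auto
  then have "(\<lambda>y. \<Sum>j\<in>UNIV. x $ j * y $ j * p y) \<in> polynomials_upto (Suc t)"
    unfolding * by (intro polynomials_upto_sum)
  then show ?thesis by (simp add: inner_vec_def sum_distrib_right)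
qed

text \<open>Horner's scheme: each step multiplies by 1 - inner x y, which raises the degree in y by
  at most one, and adds a constant.\<close>

lemma zonal_in_polynomials_upto:
  assumes "degree P \<le> t"
  shows "(\<lambda>y. poly P (1 - inner x y)) \<in> (polynomials_upto t :: (real ^ 'n \<Rightarrow> real) set)"
  using assms
proof (induction P arbitrary: t rule: pCons_induct)
  case 0
  then show ?case by (simp add: polynomials_upto_const)
next
  case (pCons a P)
  show ?case
  \<comment> \<open>A constant is compatible with t = 0, where no predecessor \<open>s\<close>
    exists.\<close>
  proof (cases "P = 0")
    case True
    then show ?thesis by (simp add: polynomials_upto_const)
  next
    case False
    with pCons.prems obtain s where t: "t = Suc s" and s: "degree P \<le> s"
      by (cases t) auto
    have P: "(\<lambda>y. poly P (1 - inner x y)) \<in> polynomials_upto s" by (rule pCons.IH[OF s])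
    have "(\<lambda>y. a + (poly P (1 - inner x y) + inner (- x) y * poly P (1 - inner x y))) \<in> polynomials_upto t"
      unfolding t using P
      by (intro polynomials_upto_add polynomials_upto_const polynomials_upto_mult_inner)
        (auto intro: polynomials_upto_mono[of s])
    then show ?thesis by (simp add: algebra_simps)
  qed
qed

subsection \<open>The energy of a design\<close>

text \<open>Translation through |x - y|^2 = 2 w. The bounds are phrased as powers of 1 / s with s =
  n |x - y| / 2, the shape required by \<open>nn_integral_decay_le\<close>.\<close>

lemma log_kernel_approx:
  fixes m n :: nat
  assumes "m \<ge> 1" "n \<ge> 1"
  obtains P :: "real poly" where "degree P \<le> m * (n - 1)"
    and "\<bar>poly P 0 - ln (real n)\<bar> \<le> 2 * real m + 2"
    and "\<And>x y :: real ^ 'n. norm x = 1 \<Longrightarrow> norm y = 1 \<Longrightarrow> x \<noteq> y \<Longrightarrow>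
      0 \<le> ln (1 / norm (x - y)) - poly P (1 - inner x y) \<and>
      ln (1 / norm (x - y)) - poly P (1 - inner x y) \<le> 1 / (real n * norm (x - y) / 2) \<and>
      ln (1 / norm (x - y)) - poly P (1 - inner x y) \<le> (1 / (real n * norm (x - y) / 2)) ^ (2 * m)"
proof -
  obtain P :: "real poly" where P: "degree P \<le> m * (n - 1)"
    "\<And>w. 0 < w \<Longrightarrow> w \<le> 2 \<Longrightarrow> poly P w \<le> - ln (2 * w) / 2"
    "\<And>w. 0 < w \<Longrightarrow> w \<le> 2 \<Longrightarrow> - ln (2 * w) / 2 - poly P w \<le> 2 / (real n * sqrt (2 * w))"
    "\<And>w. 0 < w \<Longrightarrow> w \<le> 2 \<Longrightarrow> - ln (2 * w) / 2 - poly P w \<le> (2 / (real n * sqrt (2 * w))) ^ (2 * m)"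
    "\<bar>poly P 0 - ln (real n)\<bar> \<le> 2 * real m + 2"
    using log_poly_approx[OF assms] by metis
  show thesis
  proof (rule that[OF P(1,5)])
    fix x y :: "real ^ 'n" assume x: "norm x = 1" and y: "norm y = 1" and ne: "x \<noteq> y"
    define w where "w = 1 - inner x y"
    have sq: "(norm (x - y))\<^sup>2 = 2 * w"
      using x y by (simp add: w_def power2_norm_eq_inner inner_diff inner_commute norm_eq_1)
    then have s: "sqrt (2 * w) = norm (x - y)" by (metis norm_ge_zero real_sqrt_unique)
    have "0 < (norm (x - y))\<^sup>2" using ne by simp
    then have w: "0 < w" using sq by simp
    have w2: "w \<le> 2" using Cauchy_Schwarz_ineq2[of x y] x y by (simp add: w_def)
    have "ln (1 / norm (x - y)) = - ln (sqrt (2 * w))"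
      using w unfolding s[symmetric] by (simp add: ln_div)
    also have "\<dots> = - ln (2 * w) / 2" using w by (subst ln_sqrt) auto
    finally have "ln (1 / norm (x - y)) = - ln (2 * w) / 2" .
    then show "0 \<le> ln (1 / norm (x - y)) - poly P (1 - inner x y) \<and>
      ln (1 / norm (x - y)) - poly P (1 - inner x y) \<le> 1 / (real n * norm (x - y) / 2) \<and>
      ln (1 / norm (x - y)) - poly P (1 - inner x y) \<le> (1 / (real n * norm (x - y) / 2)) ^ (2 * m)"
      using P(2-4)[OF w w2, unfolded s] unfolding w_def[symmetric] by simp
  qed
qed

lemma AE_sphere_measure_neq:
  fixes x :: "real ^ 'n"
  assumes d: "CARD('n) = d + 1" "d \<ge> 1" and x: "norm x = 1"
  shows "AE y in sphere_measure. y \<noteq> x"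
proof (rule AE_I)
  show "{y \<in> space sphere_measure. \<not> y \<noteq> x} \<subseteq> {x}" by auto
  show "{x} \<in> sets sphere_measure"
    using x by (subst sets_sphere_measure) (auto simp: sets_restrict_space_iff)
  have "emeasure sphere_measure {x} \<le> 0"
  proof (rule ennreal_le_epsilon)
    fix e :: real assume e: "0 < e"
    \<comment> \<open>The point lies in caps of every radius. Here r \<le> 1 gives r^d \<le> r, and
      the other entry of the minimum brings the cap bound below \<open>e\<close>.\<close>
    define r where "r = min 1 (e / 2 ^ (d + 3))"
    have r: "0 < r" "r \<le> 1" "2 ^ (d + 3) * r \<le> e"
      using e by (auto simp: r_def field_simps min_def)
    have "emeasure sphere_measure {x} \<le> emeasure sphere_measure {y \<in> sphere 0 1. norm (x - y) \<le> r}"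
      using x r by (intro emeasure_mono) (auto simp: sets_sphere_measure sets_restrict_space_iff)
    also have "\<dots> \<le> ennreal (2 ^ (d + 3) * r ^ d)"
      by (rule emeasure_spherical_cap_le) (use d x r in auto)
    also have "\<dots> \<le> ennreal (2 ^ (d + 3) * r)"
      using power_decreasing[of 1 d r] d r by (intro ennreal_leI mult_left_mono) auto
    also have "\<dots> \<le> 0 + ennreal e" using r by (simp add: ennreal_leI)
    finally show "emeasure sphere_measure {x} \<le> 0 + ennreal e" .
  qed
  then show "emeasure sphere_measure {x} = 0" by simp
qed

text \<open>In the scaled distance s = n |x - y| / 2, a sublevel set is a cap of radius 2 r / n.
  This produces the factor n^(-d) in \<open>B\<close>, which makes N^2 B of order N once n^d is of
  order N.\<close>

lemma sphere_integral_decay: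
  fixes x :: "real ^ 'n" and h :: "real ^ 'n \<Rightarrow> real"
  assumes d: "CARD('n) = d + 1" "d \<ge> 2" and x: "norm x = 1" and n: "n \<ge> 1"
    and h_meas: "h \<in> borel_measurable borel"
    and h: "\<And>y. norm y = 1 \<Longrightarrow> y \<noteq> x \<Longrightarrow> 0 \<le> h y \<and> h y \<le> 1 / (real n * norm (x - y) / 2) \<and>
      h y \<le> (1 / (real n * norm (x - y) / 2)) ^ (2 * d)"
  defines "B \<equiv> 2 ^ (2 * d + 3) * (4 + 2 ^ Suc d) / real n ^ d"
  shows "integrable sphere_measure h" "0 \<le> (LINT y|sphere_measure. h y)" "(LINT y|sphere_measure. h y) \<le> B"
proof -
  let ?\<sigma> = "sphere_measure :: (real ^ 'n) measure"
  define s where "s y = real n * norm (x - y) / 2" for y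
  have B0: "0 \<le> B" by (simp add: B_def)
  have ae: "AE y in ?\<sigma>. norm y = 1 \<and> y \<noteq> x"
    using AE_sphere_measure_neq[OF d(1) _ x] d(2) AE_space
    by (auto simp: space_sphere_measure elim: eventually_elim2)
  have hm: "h \<in> borel_measurable ?\<sigma>" by (rule borel_measurable_sphere_measure[OF h_meas])
  have pos: "AE y in ?\<sigma>. 0 \<le> h y" using ae by eventually_elim (use h in auto)
  have "(\<integral>\<^sup>+y. ennreal (h y) \<partial>?\<sigma>) \<le> ennreal (2 ^ (d + 3) * (2 / real n) ^ d * (4 + 2 ^ Suc d))"
  proof (rule nn_integral_decay_le[where s = s and k = "2 * d"])
    show "s \<in> borel_measurable ?\<sigma>"
      unfolding s_def by (rule borel_measurable_sphere_measure) measurable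
    show "AE y in ?\<sigma>. 0 < s y"
      using ae by eventually_elim (use n in \<open>auto simp: s_def\<close>)
    show "AE y in ?\<sigma>. h y \<le> 1 / s y \<and> h y \<le> (1 / s y) ^ (2 * d)"
      using ae by eventually_elim (use h in \<open>auto simp: s_def\<close>)
    fix r :: real assume r: "0 < r"
    have "{y \<in> space ?\<sigma>. s y \<le> r} = {y \<in> sphere 0 1. norm (x - y) \<le> 2 / real n * r}"
      using n by (auto simp: s_def space_sphere_measure field_simps)
    then have "emeasure ?\<sigma> {y \<in> space ?\<sigma>. s y \<le> r} \<le> ennreal (2 ^ (d + 3) * (2 / real n * r) ^ d)"
      using emeasure_spherical_cap_le[OF d(1) x, of "2 / real n * r"] n r by simp
    then show "emeasure ?\<sigma> {y \<in> space ?\<sigma>. s y \<le> r} \<le> ennreal (2 ^ (d + 3) * (2 / real n) ^ d * r ^ d)"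
      by (simp only: power_mult_distrib mult.assoc)
  qed (use d in auto)
  also have "2 ^ (d + 3) * (2 / real n) ^ d * (4 + 2 ^ Suc d) = B"
  proof -
    have "(2 :: real) ^ (d + 3) * 2 ^ d = 2 ^ (2 * d + 3)"
      unfolding power_add[symmetric] by (rule arg_cong[of _ _ "power 2"]) simp
    then show ?thesis unfolding B_def power_divide by (metis times_divide_eq_left times_divide_eq_right)
  qed
  finally have le: "(\<integral>\<^sup>+y. ennreal (h y) \<partial>?\<sigma>) \<le> ennreal B" .
  then show "integrable ?\<sigma> h"
    using hm pos by (intro integrableI_nonneg) (auto simp: le_less_trans)
  show "0 \<le> (LINT y|?\<sigma>. h y)" using pos by (rule integral_nonneg_AE)
  show "(LINT y|?\<sigma>. h y) \<le> B"
    using le B0 hm pos by (simp add: integral_eq_nn_integral enn2real_leI)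
qed

text \<open>The dyadic estimate for the counting measure on the other points. The radius 2 r / n and
  the separation c / n scale alike, so \<open>n\<close> and the number of points drop out of the
  bound.\<close>

lemma separated_sum_decay:
  fixes X :: "(real ^ 'n) set" and h :: "real ^ 'n \<Rightarrow> real"
  assumes d: "CARD('n) = d + 1" "d \<ge> 2" and X: "finite X" "x \<in> X" and n: "n \<ge> 1" and c: "0 < c"
    and sep: "\<And>y z. y \<in> X \<Longrightarrow> z \<in> X \<Longrightarrow> y \<noteq> z \<Longrightarrow> c < real n * norm (y - z)"
    and h: "\<And>y. y \<in> X \<Longrightarrow> y \<noteq> x \<Longrightarrow> 0 \<le> h y \<and> h y \<le> 1 / (real n * norm (x - y) / 2) \<and>
      h y \<le> (1 / (real n * norm (x - y) / 2)) ^ (2 * d)"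
  shows "(\<Sum>y\<in>X - {x}. h y) \<le> (6 / c) ^ (d + 1) * (4 + 2 ^ (d + 2))"
proof -
  let ?M = "count_space (X - {x})"
  define s where "s y = real n * norm (x - y) / 2" for y
  have "ennreal (\<Sum>y\<in>X - {x}. h y) = (\<integral>\<^sup>+y. ennreal (h y) \<partial>?M)"
    using X h by (subst sum_ennreal[symmetric]) (auto simp: nn_integral_count_space_finite)
  also have "\<dots> \<le> ennreal ((6 / c) ^ (d + 1) * (4 + 2 ^ Suc (d + 1)))"
  \<comment> \<open>The growth exponent is the ambient d + 1, since the packing takes place in the
    ambient space; the decay exponent 2 d still exceeds it because d \<ge> 2.\<close>
  proof (rule nn_integral_decay_le[where s = s and k = "2 * d"])
    show "AE y in ?M. 0 < s y" using n by (auto simp: s_def AE_count_space zero_less_mult_iff)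
    show "AE y in ?M. h y \<le> 1 / s y \<and> h y \<le> (1 / s y) ^ (2 * d)"
      using h by (auto simp: s_def AE_count_space)
    fix r :: real assume r: "0 < r"
    have e: "{y \<in> space ?M. s y \<le> r} = {y \<in> X - {x}. norm (x - y) \<le> 2 * r / real n}"
      using n by (auto simp: s_def field_simps)
    have "real (card {y \<in> X - {x}. norm (x - y) \<le> 2 * r / real n}) \<le> (3 * (2 * r / real n) / (c / real n)) ^ CARD('n)"
      by (rule card_separated_le) (use X n c r sep in \<open>auto simp: field_simps\<close>)
    also have "3 * (2 * r / real n) / (c / real n) = 6 / c * r" using n by simp
    finally have "real (card {y \<in> space ?M. s y \<le> r}) \<le> (6 / c) ^ (d + 1) * r ^ (d + 1)"
      unfolding e d(1) by (simp only: power_mult_distrib)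
    then have "ennreal (real (card {y \<in> space ?M. s y \<le> r})) \<le> ennreal ((6 / c) ^ (d + 1) * r ^ (d + 1))"
      by (rule ennreal_leI)
    moreover have "emeasure ?M {y \<in> space ?M. s y \<le> r} = ennreal (real (card {y \<in> space ?M. s y \<le> r}))"
      using X by (subst emeasure_count_space_finite) (auto simp: ennreal_of_nat_eq_real_of_nat)
    ultimately show "emeasure ?M {y \<in> space ?M. s y \<le> r} \<le> ennreal ((6 / c) ^ (d + 1) * r ^ (d + 1))"
      by simp
  qed (use d c in auto)
  finally show ?thesis using c by simp
qed

lemma integrable_zonal:
  "integrable (sphere_measure :: (real ^ 'n) measure) (\<lambda>y. poly P (1 - inner x y))"
proof -
  interpret finite_measure "sphere_measure :: (real ^ 'n) measure" by (rule finite_measure_sphere_measure)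
  have c: "continuous_on UNIV (\<lambda>y :: real ^ 'n. poly P (1 - inner x y))" by (intro continuous_intros)
  then have "bounded ((\<lambda>y. poly P (1 - inner x y)) ` (sphere 0 1 :: (real ^ 'n) set))"
    by (intro compact_imp_bounded compact_continuous_image) (auto intro: continuous_on_subset)
  then obtain b where "\<And>y :: real ^ 'n. y \<in> sphere 0 1 \<Longrightarrow> norm (poly P (1 - inner x y)) \<le> b"
    unfolding bounded_iff by (metis imageI)
  then show ?thesis using c
    by (intro integrable_const_bound[of _ b] borel_measurable_sphere_measure borel_measurable_continuous_onI)
      (auto simp: space_sphere_measure intro!: AE_I2)
qed

text \<open>The three error terms come from the off-diagonal sum of the remainder, from N^2 times
  its double integral, and from replacing P(0) by ln n on the diagonal. The bound is explicit for a
  single design and hence uniform along the sequence.\<close>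

lemma log_energy_design_bound:
  fixes X :: "(real ^ 'n) set"
  assumes d: "CARD('n) = d + 1" "d \<ge> 2" and design: "spherical_design t X" and ne: "X \<noteq> {}"
    and n: "n = t div d + 1" and c: "0 < c"
    and sep: "\<And>y z. y \<in> X \<Longrightarrow> z \<in> X \<Longrightarrow> y \<noteq> z \<Longrightarrow> c < real n * norm (y - z)"
  defines "N \<equiv> real (card X)"
  shows "\<bar>log_energy X - (N\<^sup>2 * sphere_log_integral TYPE('n) - N * ln (real n))\<bar>
    \<le> N * ((6 / c) ^ (d + 1) * (4 + 2 ^ (d + 2))) + N\<^sup>2 * (2 ^ (2 * d + 3) * (4 + 2 ^ Suc d) / real n ^ d)
      + N * (2 * real d + 2)"
proof -
  let ?\<sigma> = "sphere_measure :: (real ^ 'n) measure"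
  interpret finite_measure ?\<sigma> by (rule finite_measure_sphere_measure)
  have n1: "n \<ge> 1" and d1: "d \<ge> 1" using d n by auto
  obtain P :: "real poly" where P: "degree P \<le> d * (n - 1)" "\<bar>poly P 0 - ln (real n)\<bar> \<le> 2 * real d + 2"
    "\<And>x y :: real ^ 'n. norm x = 1 \<Longrightarrow> norm y = 1 \<Longrightarrow> x \<noteq> y \<Longrightarrow>
      0 \<le> ln (1 / norm (x - y)) - poly P (1 - inner x y) \<and>
      ln (1 / norm (x - y)) - poly P (1 - inner x y) \<le> 1 / (real n * norm (x - y) / 2) \<and>
      ln (1 / norm (x - y)) - poly P (1 - inner x y) \<le> (1 / (real n * norm (x - y) / 2)) ^ (2 * d)"
    using log_kernel_approx[OF d1 n1, where 'n = 'n] by metis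
  \<comment> \<open>\<open>n\<close> is the largest index with d (n - 1) \<le> t, so the design
    integrates the zonal polynomials of \<open>P\<close> exactly.\<close>
  have degP: "degree P \<le> t"
    using P(1) n by simp (metis dual_order.trans mult.commute div_times_less_eq_dividend)
  have X: "finite X" "X \<subseteq> sphere 0 1" using design by (auto simp: spherical_design_def)
  have N: "N > 0" using X ne by (simp add: N_def card_gt_0_iff)
  define p where "p x y = poly P (1 - inner x y)" for x y :: "real ^ 'n"
  define g where "g x y = ln (1 / norm (x - y)) - p x y" for x y :: "real ^ 'n"
  have p_comm: "p x y = p y x" for x y by (simp add: p_def inner_commute)
  have g_comm: "g x y = g y x" for x y by (simp add: g_def p_comm norm_minus_commute)
  have p_int: "integrable ?\<sigma> (p x)" for x unfolding p_def by (rule integrable_zonal)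
  have exact: "(LINT y|?\<sigma>. p x y) = (\<Sum>y\<in>X. p x y) / N" for x
    using design zonal_in_polynomials_upto[OF degP, of x]
    by (simp add: spherical_design_def p_def N_def)
  \<comment> \<open>Joint measurability is what makes the potential \<open>J\<close> measurable in
    its parameter.\<close>
  have g_meas: "case_prod g \<in> borel_measurable borel"
  proof -
    have "(\<lambda>z :: (real ^ 'n) \<times> (real ^ 'n). poly P (1 - inner (fst z) (snd z))) \<in> borel_measurable borel"
      by (intro borel_measurable_continuous_onI continuous_intros)
    moreover have "(\<lambda>z :: (real ^ 'n) \<times> (real ^ 'n). norm (fst z - snd z)) \<in> borel_measurable borel"
      by (intro borel_measurable_continuous_onI continuous_intros)
    ultimately show ?thesis unfolding g_def p_def case_prod_beta by measurable
  qed
  have g_meas1: "g x \<in> borel_measurable borel" for x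
    using measurable_compose[OF _ g_meas, of "Pair x" borel]
    by (simp add: borel_measurable_continuous_onI continuous_intros)
  define b where "b = 2 ^ (2 * d + 3) * (4 + 2 ^ Suc d) / real n ^ d"
  define J where "J y = (LINT x|?\<sigma>. g y x)" for y
  have J: "integrable ?\<sigma> (g y)" "0 \<le> J y" "J y \<le> b" if "norm y = 1" for y
    unfolding J_def b_def
    by (rule sphere_integral_decay[OF d that n1 g_meas1]; use P(3)[OF that] in \<open>auto simp: g_def p_def\<close>)+
  have J_int: "integrable ?\<sigma> J"
  proof (rule integrable_const_bound[of _ b])
    show "AE y in ?\<sigma>. norm (J y) \<le> b" using J(2,3) by (intro AE_I2) (simp add: space_sphere_measure)
    have "(\<lambda>z. z) \<in> measurable ?\<sigma> borel"
      by (subst measurable_cong_sets[OF sets_sphere_measure refl]) (simp add: measurable_restrict_space1)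
    then have "(\<lambda>z. (fst z, snd z)) \<in> measurable (?\<sigma> \<Otimes>\<^sub>M ?\<sigma>) (borel \<Otimes>\<^sub>M borel)"
      by (intro measurable_Pair) (auto intro: measurable_compose[OF measurable_fst] measurable_compose[OF measurable_snd])
    then have "case_prod g \<in> borel_measurable (?\<sigma> \<Otimes>\<^sub>M ?\<sigma>)"
      using measurable_compose[OF _ g_meas[folded borel_prod]] by simp
    then show "J \<in> borel_measurable ?\<sigma>" unfolding J_def by (rule borel_measurable_lebesgue_integral)
  qed
  have mass: "measure ?\<sigma> (space ?\<sigma>) = 1"
    by (simp add: measure_def space_sphere_measure emeasure_sphere_measure_sphere)
  have iJ: "0 \<le> (LINT y|?\<sigma>. J y)" "(LINT y|?\<sigma>. J y) \<le> b"
  proof -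
    show "0 \<le> (LINT y|?\<sigma>. J y)"
      using J(2) by (intro integral_nonneg_AE AE_I2) (simp add: space_sphere_measure)
    have "(LINT y|?\<sigma>. J y) \<le> (LINT y|?\<sigma>. b)"
      using J(3) J_int by (intro integral_mono_AE AE_I2) (simp_all add: space_sphere_measure)
    then show "(LINT y|?\<sigma>. J y) \<le> b" using mass by simp
  qed
  have V: "sphere_log_integral TYPE('n) = (\<Sum>x\<in>X. \<Sum>y\<in>X. p x y) / N\<^sup>2 + (LINT y|?\<sigma>. J y)"
  proof -
    have inner_eq: "(LINT x|?\<sigma>. ln (1 / norm (x - y))) = (\<Sum>x\<in>X. p x y) / N + J y" if "y \<in> space ?\<sigma>" for y
    proof -
      have y: "norm y = 1" using that by (simp add: space_sphere_measure)
      \<comment> \<open>The splitting holds at x = y too: \<open>g\<close> is defined there as a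
        difference with the same default value of the logarithm.\<close>
      have "(LINT x|?\<sigma>. ln (1 / norm (x - y))) = (LINT x|?\<sigma>. p y x + g y x)"
        by (intro Bochner_Integration.integral_cong) (auto simp: g_def norm_minus_commute)
      also have "\<dots> = (LINT x|?\<sigma>. p y x) + J y"
        unfolding J_def by (rule Bochner_Integration.integral_add[OF p_int J(1)[OF y]])
      also have "(LINT x|?\<sigma>. p y x) = (\<Sum>x\<in>X. p x y) / N"
        unfolding exact by (simp add: p_comm[of y])
      finally show ?thesis .
    qed
    have "sphere_log_integral TYPE('n) = (LINT y|?\<sigma>. (\<Sum>x\<in>X. p x y) / N + J y)"
      unfolding sphere_log_integral_def by (rule Bochner_Integration.integral_cong[OF refl inner_eq])
    also have "\<dots> = (LINT y|?\<sigma>. (\<Sum>x\<in>X. p x y) / N) + (LINT y|?\<sigma>. J y)"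
      by (intro Bochner_Integration.integral_add J_int integrable_divide Bochner_Integration.integrable_sum p_int)
    \<comment> \<open>The design property is applied a second time, now in y, turning the double
      integral of \<open>p\<close> into a double average over \<open>X\<close>.\<close>
    also have "(LINT y|?\<sigma>. (\<Sum>x\<in>X. p x y) / N) = (\<Sum>x\<in>X. \<Sum>y\<in>X. p x y) / N\<^sup>2"
      by (simp add: Bochner_Integration.integral_sum p_int exact power2_eq_square sum_divide_distrib[symmetric])
    finally show ?thesis .
  qed
  \<comment> \<open>Completing the sum of \<open>p\<close> by the diagonal, where p x x = P(0), is
    the source of the N ln N term.\<close>
  have E: "log_energy X = (\<Sum>x\<in>X. \<Sum>y\<in>X - {x}. g x y) + (\<Sum>x\<in>X. \<Sum>y\<in>X. p x y) - N * poly P 0"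
  proof -
    have "(\<Sum>y\<in>X - {x}. ln (1 / norm (x - y))) = (\<Sum>y\<in>X - {x}. g x y) + (\<Sum>y\<in>X. p x y) - poly P 0"
      if x: "x \<in> X" for x
    proof -
      have "inner x x = 1" using x X(2) by (auto simp: norm_eq_1)
      then have "p x x = poly P 0" by (simp add: p_def)
      moreover have "(\<Sum>y\<in>X. p x y) = p x x + (\<Sum>y\<in>X - {x}. p x y)" using X x by (simp add: sum.remove)
      ultimately show ?thesis by (simp add: g_def sum_subtractf)
    qed
    then show ?thesis by (simp add: log_energy_def sum.distrib sum_subtractf N_def)
  qed
  have gsum: "0 \<le> (\<Sum>y\<in>X - {x}. g x y)" "(\<Sum>y\<in>X - {x}. g x y) \<le> (6 / c) ^ (d + 1) * (4 + 2 ^ (d + 2))"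
    if x: "x \<in> X" for x
  proof -
    have nx: "norm y = 1" if "y \<in> X" for y using X(2) that by auto
    show "0 \<le> (\<Sum>y\<in>X - {x}. g x y)"
      using P(3)[OF nx[OF x] nx] by (intro sum_nonneg) (auto simp: g_def p_def)
    show "(\<Sum>y\<in>X - {x}. g x y) \<le> (6 / c) ^ (d + 1) * (4 + 2 ^ (d + 2))"
      by (rule separated_sum_decay[OF d X(1) x n1 c sep])
        (use P(3)[OF nx[OF x] nx] in \<open>auto simp: g_def p_def\<close>)
  qed
  have G: "0 \<le> (\<Sum>x\<in>X. \<Sum>y\<in>X - {x}. g x y)"
    "(\<Sum>x\<in>X. \<Sum>y\<in>X - {x}. g x y) \<le> N * ((6 / c) ^ (d + 1) * (4 + 2 ^ (d + 2)))"
    using gsum(1) sum_bounded_above[OF gsum(2)] by (auto simp: N_def intro: sum_nonneg)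
  \<comment> \<open>The double sum of \<open>p\<close> cancels against N^2 times its double
    integral, leaving only terms that have been bounded.\<close>
  have "log_energy X - (N\<^sup>2 * sphere_log_integral TYPE('n) - N * ln (real n))
    = (\<Sum>x\<in>X. \<Sum>y\<in>X - {x}. g x y) - N\<^sup>2 * (LINT y|?\<sigma>. J y) - N * (poly P 0 - ln (real n))"
    unfolding E V using N by (simp add: algebra_simps)
  moreover have "0 \<le> N\<^sup>2 * (LINT y|?\<sigma>. J y)" "N\<^sup>2 * (LINT y|?\<sigma>. J y) \<le> N\<^sup>2 * b"
    using iJ by (auto intro: mult_left_mono)
  moreover have "\<bar>N * (poly P 0 - ln (real n))\<bar> \<le> N * (2 * real d + 2)"
    using P(2) N by (simp add: abs_mult)
  ultimately show ?thesis using G unfolding b_def by linarith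
qed

section \<open>From the kernel index \<open>n\<close> to the cardinality \<open>N\<close>\<close>

theorem theorem1:
  fixes d :: nat and X :: "nat \<Rightarrow> (real ^ 'n) set"
  assumes "d \<ge> 2" and "CARD('n) = d + 1"
    and "\<And>t. t \<ge> 1 \<Longrightarrow> spherical_design t (X t)"
    and "well_separated d X"
    and "same_order (\<lambda>t. real (card (X t))) (\<lambda>t. real t ^ d)"
  shows "(\<lambda>t. log_energy (X t)
            - ((real (card (X t)))\<^sup>2 * sphere_log_integral TYPE('n)
               - 1 / real d * real (card (X t)) * ln (real (card (X t)))))
         \<in> O[at_top](\<lambda>t. real (card (X t)))"
proof -
  obtain c1 where c1: "c1 > 0" and sep: "\<And>t x y. t \<ge> 1 \<Longrightarrow> x \<in> X t \<Longrightarrow> y \<in> X t \<Longrightarrow> x \<noteq> y \<Longrightarrow>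
      c1 * real (card (X t)) powr (- 1 / real d) < norm (x - y)"
    using assms(4) unfolding well_separated_def by blast
  obtain C1 C2 where C: "C1 > 0" "C2 > 0"
    and ord: "\<And>t. t \<ge> 1 \<Longrightarrow> C1 * real (card (X t)) \<le> real t ^ d \<and> real t ^ d \<le> C2 * real (card (X t))"
    using assms(5) unfolding same_order_def by blast
  have d0: "real d > 0" using assms(1) by simp
  \<comment> \<open>From C1 N \<le> t^d and t \<le> d n follows N^(1/d) \<le> d n / C1^(1/d), so
    separation at scale N^(-1/d) becomes separation c / n.\<close>
  define c where "c = c1 * C1 powr (1 / real d) / real d"
  have c: "c > 0" using c1 C d0 by (simp add: c_def)
  \<comment> \<open>The first three summands are the error terms for one design divided by N, with N
    / n^d \<le> d^d / C1; the last group bounds the gap between ln n and ln N / d.\<close>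
  define L where "L = (6 / c) ^ (d + 1) * (4 + 2 ^ (d + 2))
    + 2 ^ (2 * d + 3) * (4 + 2 ^ Suc d) * (real d ^ d / C1) + (2 * real d + 2)
    + (ln (real d) + \<bar>ln C1\<bar> + \<bar>ln C2\<bar> + 1)"
  show ?thesis
  proof (rule bigoI[of _ L], rule eventually_at_top_linorderI[of 1])
    fix t :: nat assume t: "1 \<le> t"
    define n where "n = t div d + 1"
    define N where "N = real (card (X t))"
    have ordN: "C1 * N \<le> real t ^ d" "real t ^ d \<le> C2 * N" using ord[OF t] by (auto simp: N_def)
    have "0 < real t ^ d" using t by simp
    then have N: "N > 0" using ordN(2) C(2) by (smt (verit) mult_nonneg_nonpos)
    then have ne: "X t \<noteq> {}" by (auto simp: N_def)
    \<comment> \<open>\<open>n\<close> lies between t / d and 2 t, which makes it comparable with t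
      and hence with N^(1/d).\<close>
    have "t < d * n" unfolding n_def using assms(1)
      by (metis Suc_eq_plus1 dividend_less_times_div less_le_trans mult_Suc_right nat_add_left_cancel_less pos2 add.commute)
    then have tn: "real t \<le> real d * real n" by (metis less_imp_le of_nat_le_iff of_nat_mult)
    have nt: "n \<le> 2 * t" unfolding n_def using t div_le_dividend[of t d] by linarith
    have n1: "n \<ge> 1" by (simp add: n_def)
    have lnN: "ln C1 + ln N \<le> real d * ln (real t)" "real d * ln (real t) \<le> ln C2 + ln N"
    proof -
      have "ln (C1 * N) \<le> ln (real t ^ d)" "ln (real t ^ d) \<le> ln (C2 * N)"
        using ordN N C t by (simp_all add: zero_less_mult_iff)
      then show "ln C1 + ln N \<le> real d * ln (real t)" "real d * ln (real t) \<le> ln C2 + ln N"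
        using N C t by (simp_all add: ln_mult ln_realpow)
    qed
    have lnn: "ln (real t) \<le> ln (real d) + ln (real n)" "ln (real n) \<le> 1 + ln (real t)"
    proof -
      have "ln (real t) \<le> ln (real d * real n)" using tn t by simp
      then show "ln (real t) \<le> ln (real d) + ln (real n)" using d0 n1 by (simp add: ln_mult)
      have "ln (real n) \<le> ln (2 * real t)" using nt n1 by simp
      also have "\<dots> = ln 2 + ln (real t)" using t by (simp add: ln_mult)
      finally show "ln (real n) \<le> 1 + ln (real t)" using ln_le_minus_one[of "2::real"] by simp
    qed
    \<comment> \<open>Both quantities are within a constant of ln t; dividing ln C1 and ln C2 by d
      \<ge> 1 does not increase their absolute values.\<close>
    have lndiff: "\<bar>ln (real n) - 1 / real d * ln N\<bar> \<le> ln (real d) + \<bar>ln C1\<bar> + \<bar>ln C2\<bar> + 1"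
    proof -
      have q: "\<bar>u / real d\<bar> \<le> \<bar>u\<bar>" for u
        using assms(1) by (simp add: abs_divide divide_le_eq mult_left_le mult_le_cancel_left1 mult.commute)
      have "ln C1 / real d + 1 / real d * ln N \<le> ln (real t)" "ln (real t) \<le> ln C2 / real d + 1 / real d * ln N"
        using lnN d0 by (simp_all add: field_simps)
      moreover have "0 \<le> ln (real d)" using assms(1) by simp
      ultimately show ?thesis using lnn q[of "ln C1"] q[of "ln C2"] by linarith
    qed
    have sep': "c < real n * norm (y - z)" if yz: "y \<in> X t" "z \<in> X t" "y \<noteq> z" for y z
    proof -
      have "(C1 * N) powr (1 / real d) \<le> (real t ^ d) powr (1 / real d)"
        using ordN N C d0 by (intro powr_mono2) auto
      also have "\<dots> = real t" using t d0 by (simp add: powr_realpow[symmetric] powr_powr)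
      finally have "C1 powr (1 / real d) * N powr (1 / real d) \<le> real d * real n"
        using tn N C by (simp add: powr_mult)
      then have "C1 powr (1 / real d) / real d \<le> real n * N powr (- 1 / real d)"
        using N d0 by (simp add: powr_minus field_simps)
      then have "c1 * (C1 powr (1 / real d) / real d) \<le> c1 * (real n * N powr (- 1 / real d))"
        using c1 by (intro mult_left_mono) auto
      also have "\<dots> = real n * (c1 * N powr (- 1 / real d))" by simp
      also have "\<dots> < real n * norm (y - z)"
        using sep[OF t yz] n1 by (intro mult_strict_left_mono) (auto simp: N_def)
      finally show ?thesis by (simp add: c_def)
    qed
    \<comment> \<open>This turns the integral error N^2 / n^d into a multiple of N.\<close>
    have "N / real n ^ d \<le> real d ^ d / C1"
    proof -
      have "C1 * N \<le> (real d * real n) ^ d"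
        using ordN(1) power_mono[OF tn, of d] by simp
      then show ?thesis using C n1 by (simp add: field_simps power_mult_distrib)
    qed
    then have b: "N * (2 ^ (2 * d + 3) * (4 + 2 ^ Suc d)) * (N / real n ^ d)
        \<le> N * (2 ^ (2 * d + 3) * (4 + 2 ^ Suc d)) * (real d ^ d / C1)"
      using N by (intro mult_left_mono) auto
    have m: "\<bar>log_energy (X t) - (N\<^sup>2 * sphere_log_integral TYPE('n) - N * ln (real n))\<bar>
      \<le> N * ((6 / c) ^ (d + 1) * (4 + 2 ^ (d + 2)))
        + N\<^sup>2 * (2 ^ (2 * d + 3) * (4 + 2 ^ Suc d) / real n ^ d) + N * (2 * real d + 2)"
      unfolding N_def
      by (rule log_energy_design_bound[OF assms(2,1) assms(3)[OF t] ne n_def c sep'])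
    also have "\<dots> \<le> N * ((6 / c) ^ (d + 1) * (4 + 2 ^ (d + 2)))
        + N * (2 ^ (2 * d + 3) * (4 + 2 ^ Suc d)) * (real d ^ d / C1) + N * (2 * real d + 2)"
      using b by (simp add: power2_eq_square mult_ac)
    finally have m: "\<bar>log_energy (X t) - (N\<^sup>2 * sphere_log_integral TYPE('n) - N * ln (real n))\<bar> \<le> \<dots>" .
    have k: "N * \<bar>ln (real n) - 1 / real d * ln N\<bar> \<le> N * (ln (real d) + \<bar>ln C1\<bar> + \<bar>ln C2\<bar> + 1)"
      using lndiff N by (intro mult_left_mono) auto
    have "\<bar>log_energy (X t) - (N\<^sup>2 * sphere_log_integral TYPE('n) - 1 / real d * N * ln N)\<bar>
      = \<bar>(log_energy (X t) - (N\<^sup>2 * sphere_log_integral TYPE('n) - N * ln (real n)))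
         - N * (ln (real n) - 1 / real d * ln N)\<bar>"
      by (simp add: algebra_simps)
    also have "\<dots> \<le> \<bar>log_energy (X t) - (N\<^sup>2 * sphere_log_integral TYPE('n) - N * ln (real n))\<bar>
         + N * \<bar>ln (real n) - 1 / real d * ln N\<bar>"
      using abs_triangle_ineq4 N by (metis abs_mult abs_of_pos)
    also have "\<dots> \<le> L * N"
      using m k unfolding L_def by (simp add: algebra_simps)
    finally show "norm (log_energy (X t)
            - ((real (card (X t)))\<^sup>2 * sphere_log_integral TYPE('n)
               - 1 / real d * real (card (X t)) * ln (real (card (X t))))) \<le> L * norm (real (card (X t)))"
      by (simp add: N_def)
  qed
qed

end
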